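(* Let $\mathbf M$ and $\mathbf D$ be double Boolean algebras and $h:\mathbf M\to\mathbf D$ a dBa quasi-isomorphism. Define $\alpha_h:\mathcal F_{pr}(\mathbf D)\to\mathcal F_{pr}(\mathbf M)$ by $\alpha_h(F):=h^{-1}(F)$ and $\beta_h:\mathcal I_{pr}(\mathbf D)\to\mathcal I_{pr}(\mathbf M)$ by $\beta_h(I):=h^{-1}(I)$. Then $(\alpha_h,\beta_h)$ is a CTSCR-homeomorphism from $\mathbb K^T_{pr}(\mathbf D)$ to $\mathbb K^T_{pr}(\mathbf M)$.
   Context: A double Boolean algebra (dBa) is an algebra $\mathbf{D}=(D,\sqcup,\sqcap,\neg,\lrcorner,\top,\bot)$ of type $(2,2,1,1,0,0)$ such that, with $x\vee y:=\neg(\neg x\sqcap\neg y)$ and $x\wedge y:=\lrcorner(\lrcorner x\sqcup\lrcorner y)$, for all $x,y,z\in D$: $(x\sqcap x)\sqcap y=x\sqcap y$; $x\sqcap y=y\sqcap x$; $x\sqcap(y\sqcap z)=(x\sqcap y)\sqcap z$; $\neg(x\sqcap x)=\neg x$; $x\sqcap(x\sqcup y)=x\sqcap x$; $x\sqcap(y\vee z)=(x\sqcap y)\vee(x\sqcap z)$; $x\sqcap(x\vee y)=x\sqcap x$; $\neg\neg(x\sqcap y)=x\sqcap y$; $x\sqcap\neg x=\bot$; $\neg\bot=\top\sqcap\top$; $\neg\top=\bot$; the duals $(x\sqcup x)\sqcup y=x\sqcup y$; $x\sqcup y=y\sqcup x$; $x\sqcup(y\sqcup z)=(x\sqcup y)\sqcup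 z$; $\lrcorner(x\sqcup x)=\lrcorner x$; $x\sqcup(x\sqcap y)=x\sqcup x$; $x\sqcup(y\wedge z)=(x\sqcup y)\wedge(x\sqcup z)$; $x\sqcup(x\wedge y)=x\sqcup x$; $\lrcorner\lrcorner(x\sqcup y)=x\sqcup y$; $x\sqcup\lrcorner x=\top$; $\lrcorner\top=\bot\sqcup\bot$; $\lrcorner\bot=\top$; and $(x\sqcap x)\sqcup(x\sqcap x)=(x\sqcup x)\sqcap(x\sqcup x)$. The quasi-order is $x\sqsubseteq y$ iff $x\sqcap y=x\sqcap x$ and $x\sqcup y=y\sqcup y$. A dBa homomorphism preserves $\sqcup,\sqcap,\neg,\lrcorner,\top,\bot$; a quasi-isomorphism is a surjective homomorphism $h$ with $x\sqsubseteq y\iff h(x)\sqsubseteq h(y)$. A filter is $F\subseteq D$ closed under $\sqcap$ and upward closed; an ideal is $I\subseteq D$ closed under $\sqcup$ and downward closed. Primary filter: filter $F\ne D$ with $x\in F$ or $\neg x\in F$ for all $x$; primary ideal: ideal $I\neq D$ with $x\in I$ or $\lrcorner x\in I$ for all $x$ (preimages of primary filters/ideals under dBa homomorphisms are primary, so $\alpha_h,\beta_h$ are well-defined). $\mathcal F_{pr}$, $\mathcal I_{pr}$ are their sets; $F_x:=\{F:x\in F\}$, $I_x:=\{I:x\in I\}$; $\mathcal T$, $\mathcal J$ are the topologies having $\{F_x\}$, $\{I_x\}$ as subbases of closed sets; $\mathbb K^T_{pr}(\mathbf D):=((\mathcal F_{pr}(\mathbf D),\mathcal T),(\mathcal I_{pr}(\mathbf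 D),\mathcal J),\nabla)$, $F\nabla I$ iff $F\cap I=\emptyset$. A CTSCR-homeomorphism between $((G_1,\rho_1),(M_1,\tau_1),R_1)$ and $((G_2,\rho_2),(M_2,\tau_2),R_2)$ is a pair of homeomorphisms $\alpha:G_1\to G_2$, $\beta:M_1\to M_2$ with $gR_1m\iff\alpha(g)R_2\beta(m)$. *)

theory Defs
  imports "HOL-Analysis.Abstract_Topology" "HOL-Algebra.Congruence"
begin

record 'a dba = "'a partial_object" +
  djoin :: "'a \<Rightarrow> 'a \<Rightarrow> 'a" (infixl \<open>\<squnion>\<index>\<close> 65)
  dmeet :: "'a \<Rightarrow> 'a \<Rightarrow> 'a" (infixl \<open>\<sqinter>\<index>\<close> 70)
  dneg :: "'a \<Rightarrow> 'a" (\<open>\<^bold>\<not>\<index> _\<close> [81] 80)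
  dopp :: "'a \<Rightarrow> 'a" (\<open>\<^bold>\<rfloor>\<index> _\<close> [81] 80)
  dtop :: 'a (\<open>\<top>\<index>\<close>)
  dbot :: 'a (\<open>\<bottom>\<index>\<close>)

definition dvee :: "('a, 'b) dba_scheme \<Rightarrow> 'a \<Rightarrow> 'a \<Rightarrow> 'a" (infixl \<open>\<curlyvee>\<index>\<close> 65)
  where "x \<curlyvee>\<^bsub>D\<^esub> y = \<^bold>\<not>\<^bsub>D\<^esub> (\<^bold>\<not>\<^bsub>D\<^esub> x \<sqinter>\<^bsub>D\<^esub> \<^bold>\<not>\<^bsub>D\<^esub> y)"

definition dwedge :: "('a, 'b) dba_scheme \<Rightarrow> 'a \<Rightarrow> 'a \<Rightarrow> 'a" (infixl \<open>\<curlywedge>\<index>\<close> 70)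
  where "x \<curlywedge>\<^bsub>D\<^esub> y = \<^bold>\<rfloor>\<^bsub>D\<^esub> (\<^bold>\<rfloor>\<^bsub>D\<^esub> x \<squnion>\<^bsub>D\<^esub> \<^bold>\<rfloor>\<^bsub>D\<^esub> y)"

locale double_boolean_algebra =
  fixes D (structure)
  assumes join_closed: "\<lbrakk>x \<in> carrier D; y \<in> carrier D\<rbrakk> \<Longrightarrow> x \<squnion> y \<in> carrier D"
    and meet_closed: "\<lbrakk>x \<in> carrier D; y \<in> carrier D\<rbrakk> \<Longrightarrow> x \<sqinter> y \<in> carrier D"
    and neg_closed: "x \<in> carrier D \<Longrightarrow> \<^bold>\<not> x \<in> carrier D"
    and opp_closed: "x \<in> carrier D \<Longrightarrow> \<^bold>\<rfloor> x \<in> carrier D"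
    and top_closed: "\<top> \<in> carrier D"
    and bot_closed: "\<bottom> \<in> carrier D"
    and meet_idem_left: "\<lbrakk>x \<in> carrier D; y \<in> carrier D\<rbrakk> \<Longrightarrow> (x \<sqinter> x) \<sqinter> y = x \<sqinter> y"
    and meet_comm: "\<lbrakk>x \<in> carrier D; y \<in> carrier D\<rbrakk> \<Longrightarrow> x \<sqinter> y = y \<sqinter> x"
    and meet_assoc: "\<lbrakk>x \<in> carrier D; y \<in> carrier D; z \<in> carrier D\<rbrakk>
          \<Longrightarrow> x \<sqinter> (y \<sqinter> z) = (x \<sqinter> y) \<sqinter> z"
    and neg_meet_idem: "x \<in> carrier D \<Longrightarrow> \<^bold>\<not> (x \<sqinter> x) = \<^bold>\<not> x"
    and meet_join_absorb: "\<lbrakk>x \<in> carrier D; y \<in> carrier D\<rbrakk> \<Longrightarrow> x \<sqinter> (x \<squnion> y) = x \<sqinter> x"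
    and meet_vee_distrib: "\<lbrakk>x \<in> carrier D; y \<in> carrier D; z \<in> carrier D\<rbrakk>
          \<Longrightarrow> x \<sqinter> (y \<curlyvee> z) = (x \<sqinter> y) \<curlyvee> (x \<sqinter> z)"
    and meet_vee_absorb: "\<lbrakk>x \<in> carrier D; y \<in> carrier D\<rbrakk> \<Longrightarrow> x \<sqinter> (x \<curlyvee> y) = x \<sqinter> x"
    and neg_neg_meet: "\<lbrakk>x \<in> carrier D; y \<in> carrier D\<rbrakk> \<Longrightarrow> \<^bold>\<not> (\<^bold>\<not> (x \<sqinter> y)) = x \<sqinter> y"
    and meet_neg: "x \<in> carrier D \<Longrightarrow> x \<sqinter> \<^bold>\<not> x = \<bottom>"
    and neg_bot: "\<^bold>\<not> \<bottom> = \<top> \<sqinter> \<top>"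
    and neg_top: "\<^bold>\<not> \<top> = \<bottom>"
    and join_idem_left: "\<lbrakk>x \<in> carrier D; y \<in> carrier D\<rbrakk> \<Longrightarrow> (x \<squnion> x) \<squnion> y = x \<squnion> y"
    and join_comm: "\<lbrakk>x \<in> carrier D; y \<in> carrier D\<rbrakk> \<Longrightarrow> x \<squnion> y = y \<squnion> x"
    and join_assoc: "\<lbrakk>x \<in> carrier D; y \<in> carrier D; z \<in> carrier D\<rbrakk>
          \<Longrightarrow> x \<squnion> (y \<squnion> z) = (x \<squnion> y) \<squnion> z"
    and opp_join_idem: "x \<in> carrier D \<Longrightarrow> \<^bold>\<rfloor> (x \<squnion> x) = \<^bold>\<rfloor> x"
    and join_meet_absorb: "\<lbrakk>x \<in> carrier D; y \<in> carrier D\<rbrakk> \<Longrightarrow> x \<squnion> (x \<sqinter> y) = x \<squnion> x"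
    and join_wedge_distrib: "\<lbrakk>x \<in> carrier D; y \<in> carrier D; z \<in> carrier D\<rbrakk>
          \<Longrightarrow> x \<squnion> (y \<curlywedge> z) = (x \<squnion> y) \<curlywedge> (x \<squnion> z)"
    and join_wedge_absorb: "\<lbrakk>x \<in> carrier D; y \<in> carrier D\<rbrakk> \<Longrightarrow> x \<squnion> (x \<curlywedge> y) = x \<squnion> x"
    and opp_opp_join: "\<lbrakk>x \<in> carrier D; y \<in> carrier D\<rbrakk> \<Longrightarrow> \<^bold>\<rfloor> (\<^bold>\<rfloor> (x \<squnion> y)) = x \<squnion> y"
    and join_opp: "x \<in> carrier D \<Longrightarrow> x \<squnion> \<^bold>\<rfloor> x = \<top>"
    and opp_top: "\<^bold>\<rfloor> \<top> = \<bottom> \<squnion> \<bottom>"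
    and opp_bot: "\<^bold>\<rfloor> \<bottom> = \<top>"
    and meet_join_idem: "x \<in> carrier D \<Longrightarrow> (x \<sqinter> x) \<squnion> (x \<sqinter> x) = (x \<squnion> x) \<sqinter> (x \<squnion> x)"

definition dba_le :: "('a, 'b) dba_scheme \<Rightarrow> 'a \<Rightarrow> 'a \<Rightarrow> bool" (infix \<open>\<sqsubseteq>\<index>\<close> 50)
  where "x \<sqsubseteq>\<^bsub>D\<^esub> y \<longleftrightarrow> x \<sqinter>\<^bsub>D\<^esub> y = x \<sqinter>\<^bsub>D\<^esub> x \<and> x \<squnion>\<^bsub>D\<^esub> y = y \<squnion>\<^bsub>D\<^esub> y"

definition dba_hom :: "('a, 'c) dba_scheme \<Rightarrow> ('b, 'd) dba_scheme \<Rightarrow> ('a \<Rightarrow> 'b) \<Rightarrow> bool"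
  where "dba_hom M D h \<longleftrightarrow>
    h \<in> carrier M \<rightarrow> carrier D \<and>
    (\<forall>x\<in>carrier M. \<forall>y\<in>carrier M. h (x \<squnion>\<^bsub>M\<^esub> y) = h x \<squnion>\<^bsub>D\<^esub> h y) \<and>
    (\<forall>x\<in>carrier M. \<forall>y\<in>carrier M. h (x \<sqinter>\<^bsub>M\<^esub> y) = h x \<sqinter>\<^bsub>D\<^esub> h y) \<and>
    (\<forall>x\<in>carrier M. h (\<^bold>\<not>\<^bsub>M\<^esub> x) = \<^bold>\<not>\<^bsub>D\<^esub> (h x)) \<and>
    (\<forall>x\<in>carrier M. h (\<^bold>\<rfloor>\<^bsub>M\<^esub> x) = \<^bold>\<rfloor>\<^bsub>D\<^esub> (h x)) \<and>
    h \<top>\<^bsub>M\<^esub> = \<top>\<^bsub>D\<^esub> \<and>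
    h \<bottom>\<^bsub>M\<^esub> = \<bottom>\<^bsub>D\<^esub>"

definition dba_quasi_iso :: "('a, 'c) dba_scheme \<Rightarrow> ('b, 'd) dba_scheme \<Rightarrow> ('a \<Rightarrow> 'b) \<Rightarrow> bool"
  where "dba_quasi_iso M D h \<longleftrightarrow>
    dba_hom M D h \<and>
    h ` carrier M = carrier D \<and>
    (\<forall>x\<in>carrier M. \<forall>y\<in>carrier M. x \<sqsubseteq>\<^bsub>M\<^esub> y \<longleftrightarrow> h x \<sqsubseteq>\<^bsub>D\<^esub> h y)"

definition dba_filter :: "('a, 'b) dba_scheme \<Rightarrow> 'a set \<Rightarrow> bool"
  where "dba_filter D F \<longleftrightarrow>
    F \<subseteq> carrier D \<and>
    (\<forall>x\<in>F. \<forall>y\<in>F. x \<sqinter>\<^bsub>D\<^esub> y \<in> F) \<and>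
    (\<forall>x\<in>F. \<forall>z\<in>carrier D. x \<sqsubseteq>\<^bsub>D\<^esub> z \<longrightarrow> z \<in> F)"

definition dba_ideal :: "('a, 'b) dba_scheme \<Rightarrow> 'a set \<Rightarrow> bool"
  where "dba_ideal D I \<longleftrightarrow>
    I \<subseteq> carrier D \<and>
    (\<forall>x\<in>I. \<forall>y\<in>I. x \<squnion>\<^bsub>D\<^esub> y \<in> I) \<and>
    (\<forall>x\<in>I. \<forall>z\<in>carrier D. z \<sqsubseteq>\<^bsub>D\<^esub> x \<longrightarrow> z \<in> I)"

definition primary_filters :: "('a, 'b) dba_scheme \<Rightarrow> 'a set set"
  where "primary_filters D =
    {F. dba_filter D F \<and> F \<noteq> carrier D \<and> (\<forall>x\<in>carrier D. x \<in> F \<or> \<^bold>\<not>\<^bsub>D\<^esub> x \<in> F)}"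

definition primary_ideals :: "('a, 'b) dba_scheme \<Rightarrow> 'a set set"
  where "primary_ideals D =
    {I. dba_ideal D I \<and> I \<noteq> carrier D \<and> (\<forall>x\<in>carrier D. x \<in> I \<or> \<^bold>\<rfloor>\<^bsub>D\<^esub> x \<in> I)}"

definition filters_at :: "('a, 'b) dba_scheme \<Rightarrow> 'a \<Rightarrow> 'a set set"
  where "filters_at D x = {F \<in> primary_filters D. x \<in> F}"

definition ideals_at :: "('a, 'b) dba_scheme \<Rightarrow> 'a \<Rightarrow> 'a set set"
  where "ideals_at D x = {I \<in> primary_ideals D. x \<in> I}"

text \<open>The topology on \<open>X\<close> with subbase of closed sets \<open>\<C>\<close>: the complements in \<open>X\<close> of the
  members of \<open>\<C>\<close> form a subbase of open sets.\<close>

definition closed_subbase_topology :: "'a set \<Rightarrow> 'a set set \<Rightarrow> 'a topology"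
  where "closed_subbase_topology X \<C> =
    topology (arbitrary union_of (finite intersection_of (\<lambda>U. \<exists>C\<in>\<C>. U = X - C) relative_to X))"

lemma topspace_closed_subbase_topology [simp]: "topspace (closed_subbase_topology X \<C>) = X"
  by (simp add: closed_subbase_topology_def)

lemma closedin_closed_subbase_topology:
  assumes "C \<in> \<C>" "C \<subseteq> X"
  shows "closedin (closed_subbase_topology X \<C>) C"
proof -
  have "openin (closed_subbase_topology X \<C>) (X \<inter> (X - C))"
    unfolding closed_subbase_topology_def openin_subbase using assms(1)
    by (intro arbitrary_union_of_inc relative_to_inc finite_intersection_of_inc) blast
  then show ?thesis
    using assms(2) by (simp add: closedin_def Int_absorb1)
qed

definition filter_topology :: "('a, 'b) dba_scheme \<Rightarrow> 'a set topology"
  where "filter_topology D =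
    closed_subbase_topology (primary_filters D) (filters_at D ` carrier D)"

definition ideal_topology :: "('a, 'b) dba_scheme \<Rightarrow> 'a set topology"
  where "ideal_topology D =
    closed_subbase_topology (primary_ideals D) (ideals_at D ` carrier D)"

record ('g, 'm) top_context =
  obj_space :: "'g topology"
  att_space :: "'m topology"
  incidence :: "'g \<Rightarrow> 'm \<Rightarrow> bool"

definition primary_top_context :: "('a, 'b) dba_scheme \<Rightarrow> ('a set, 'a set) top_context"
  where "primary_top_context D =
    \<lparr>obj_space = filter_topology D, att_space = ideal_topology D,
     incidence = (\<lambda>F I. F \<inter> I = {})\<rparr>"

definition CTSCR_homeomorphism ::
    "('g, 'm) top_context \<Rightarrow> ('h, 'n) top_context \<Rightarrow> ('g \<Rightarrow> 'h) \<Rightarrow> ('m \<Rightarrow> 'n) \<Rightarrow> bool"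
  where "CTSCR_homeomorphism K L \<alpha> \<beta> \<longleftrightarrow>
    homeomorphic_map (obj_space K) (obj_space L) \<alpha> \<and>
    homeomorphic_map (att_space K) (att_space L) \<beta> \<and>
    (\<forall>g \<in> topspace (obj_space K). \<forall>m \<in> topspace (att_space K).
       incidence K g m \<longleftrightarrow> incidence L (\<alpha> g) (\<beta> m))"

text \<open>The maps \<open>\<alpha>\<^sub>h\<close> and \<open>\<beta>\<^sub>h\<close> are both the preimage under \<open>h\<close>, taken inside the carrier of \<open>M\<close>.\<close>

definition alpha_map :: "('a, 'c) dba_scheme \<Rightarrow> ('a \<Rightarrow> 'b) \<Rightarrow> 'b set \<Rightarrow> 'a set"
  where "alpha_map M h F = {x \<in> carrier M. h x \<in> F}"

definition beta_map :: "('a, 'c) dba_scheme \<Rightarrow> ('a \<Rightarrow> 'b) \<Rightarrow> 'b set \<Rightarrow> 'a set"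
  where "beta_map M h I = {x \<in> carrier M. h x \<in> I}"

end

theory Submission
  imports Defs
begin

text \<open>Since \<open>\<sqsubseteq>\<close> is reflexive and \<open>h\<close> reflects it, elements with the same image under \<open>h\<close> lie below
  each other, so filters of \<open>M\<close> are unions of fibres of \<open>h\<close>. Hence \<open>G \<mapsto> h ` G\<close> inverts the
  preimage map on primary filters, and this bijection matches the subbasic closed set at \<open>h x\<close>
  with the one at \<open>x\<close>. The case of ideals is the case of filters for the dual algebras.\<close>

text \<open>Preimages under a map from \<open>X\<close> to \<open>Y\<close> commute with
  complements, so matching subbasic closed sets makes preimages of subbasic open sets open. The form
  \<open>X \<inter> B\<close> leaves \<open>B\<close> free to exceed \<open>X\<close>.\<close>

lemma continuous_map_closed_subbase_topology:
  assumes "f \<in> X \<rightarrow> Y" and "\<And>C. C \<in> \<D> \<Longrightarrow> \<exists>B\<in>\<C>. {x \<in> X. f x \<in> C} = X \<inter> B"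
  shows "continuous_map (closed_subbase_topology X \<C>) (closed_subbase_topology Y \<D>) f"
  unfolding closed_subbase_topology_def[of Y]
proof (rule continuous_map_into_topology_subbase)
  fix U assume "\<exists>C\<in>\<D>. U = Y - C"
  then obtain C B where B: "U = Y - C" "B \<in> \<C>" "{x \<in> X. f x \<in> C} = X \<inter> B"
    using assms(2) by metis
  have "openin (closed_subbase_topology X \<C>) (X \<inter> (X - B))"
    unfolding closed_subbase_topology_def openin_subbase using B(2)
    by (intro arbitrary_union_of_inc relative_to_inc finite_intersection_of_inc) blast
  moreover have "{x \<in> X. f x \<in> U} = X \<inter> (X - B)"
    using B assms(1) by blast
  ultimately show "openin (closed_subbase_topology X \<C>)
      {x \<in> topspace (closed_subbase_topology X \<C>). f x \<in> U}"
    by simp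
qed (use assms(1) in auto)

lemma dba_le_refl: "x \<sqsubseteq>\<^bsub>D\<^esub> x"
  by (simp add: dba_le_def)

lemma alpha_map_primary_filter:
  assumes "double_boolean_algebra M" "dba_quasi_iso M D h" "F \<in> primary_filters D"
  shows "alpha_map M h F \<in> primary_filters M"
proof -
  interpret M: double_boolean_algebra M by fact
  have h: "dba_hom M D h" "h ` carrier M = carrier D"
    "\<And>x y. \<lbrakk>x \<in> carrier M; y \<in> carrier M\<rbrakk> \<Longrightarrow> x \<sqsubseteq>\<^bsub>M\<^esub> y \<longleftrightarrow> h x \<sqsubseteq>\<^bsub>D\<^esub> h y"
    using assms(2) by (auto simp: dba_quasi_iso_def)
  have F: "F \<subseteq> carrier D" "F \<noteq> carrier D" "\<And>x y. \<lbrakk>x \<in> F; y \<in> F\<rbrakk> \<Longrightarrow> x \<sqinter>\<^bsub>D\<^esub> y \<in> F"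
    "\<And>x z. \<lbrakk>x \<in> F; z \<in> carrier D; x \<sqsubseteq>\<^bsub>D\<^esub> z\<rbrakk> \<Longrightarrow> z \<in> F"
    "\<And>x. x \<in> carrier D \<Longrightarrow> x \<in> F \<or> \<^bold>\<not>\<^bsub>D\<^esub> x \<in> F"
    using assms(3) by (auto simp: primary_filters_def dba_filter_def)
  \<comment> \<open>Surjectivity: an element of \<open>carrier D\<close> outside \<open>F\<close>
    has a preimage under \<open>h\<close>, which lies outside
    \<open>alpha_map M h F\<close>.\<close>
  have "alpha_map M h F \<noteq> carrier M"
    using F(1,2) unfolding alpha_map_def h(2)[symmetric] by blast
  moreover have "dba_filter M (alpha_map M h F)"
  proof -
    have "h z \<in> F" if "x \<in> carrier M" "h x \<in> F" "z \<in> carrier M" "x \<sqsubseteq>\<^bsub>M\<^esub> z" for x z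
      using that h(2,3) F(4) by blast
    moreover have "h (x \<sqinter>\<^bsub>M\<^esub> y) \<in> F"
      if "x \<in> carrier M" "h x \<in> F" "y \<in> carrier M" "h y \<in> F" for x y
      using that h(1) F(3) by (simp add: dba_hom_def)
    ultimately show ?thesis
      by (auto simp: dba_filter_def alpha_map_def M.meet_closed)
  qed
  moreover have "x \<in> alpha_map M h F \<or> \<^bold>\<not>\<^bsub>M\<^esub> x \<in> alpha_map M h F" if "x \<in> carrier M" for x
    using that h(1) F(5)[of "h x"] by (auto simp: alpha_map_def dba_hom_def M.neg_closed)
  ultimately show ?thesis
    by (auto simp: primary_filters_def)
qed

text \<open>If \<open>h x = h g\<close> with \<open>g\<close> in \<open>G\<close>, reflexivity puts
  \<open>h g\<close> below \<open>h x\<close>, reflection puts \<open>g\<close> below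
  \<open>x\<close>, and upward closure gives \<open>x \<in> G\<close>. Thus \<open>G\<close> is
  saturated although \<open>h\<close> need not be injective.\<close>

lemma alpha_map_image_filter:
  assumes "dba_quasi_iso M D h" "dba_filter M G"
  shows "alpha_map M h (h ` G) = G"
proof
  show "G \<subseteq> alpha_map M h (h ` G)"
    using assms(2) by (auto simp: dba_filter_def alpha_map_def)
  show "alpha_map M h (h ` G) \<subseteq> G"
  proof
    fix x assume "x \<in> alpha_map M h (h ` G)"
    then obtain g where g: "x \<in> carrier M" "g \<in> G" "h x = h g"
      by (auto simp: alpha_map_def)
    moreover have "g \<in> carrier M"
      using assms(2) g(2) by (auto simp: dba_filter_def)
    ultimately have "g \<sqsubseteq>\<^bsub>M\<^esub> x"
      using assms(1) by (simp add: dba_quasi_iso_def dba_le_refl)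
    then show "x \<in> G"
      using assms(2) g by (auto simp: dba_filter_def)
  qed
qed

text \<open>For upward closure, an element \<open>w\<close> above \<open>h x\<close> is lifted by
  surjectivity to some \<open>z\<close>, and reflection of the order then puts \<open>z\<close>
  above \<open>x\<close>.\<close>

lemma image_primary_filter:
  assumes "dba_quasi_iso M D h" "G \<in> primary_filters M"
  shows "h ` G \<in> primary_filters D"
proof -
  have h: "dba_hom M D h" "h ` carrier M = carrier D"
    "\<And>x y. \<lbrakk>x \<in> carrier M; y \<in> carrier M\<rbrakk> \<Longrightarrow> x \<sqsubseteq>\<^bsub>M\<^esub> y \<longleftrightarrow> h x \<sqsubseteq>\<^bsub>D\<^esub> h y"
    using assms(1) by (auto simp: dba_quasi_iso_def)
  have G: "dba_filter M G" "G \<subseteq> carrier M" "G \<noteq> carrier M"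
    "\<And>x y. \<lbrakk>x \<in> G; y \<in> G\<rbrakk> \<Longrightarrow> x \<sqinter>\<^bsub>M\<^esub> y \<in> G"
    "\<And>x z. \<lbrakk>x \<in> G; z \<in> carrier M; x \<sqsubseteq>\<^bsub>M\<^esub> z\<rbrakk> \<Longrightarrow> z \<in> G"
    "\<And>x. x \<in> carrier M \<Longrightarrow> x \<in> G \<or> \<^bold>\<not>\<^bsub>M\<^esub> x \<in> G"
    using assms(2) by (auto simp: primary_filters_def dba_filter_def)
  have "h x \<sqinter>\<^bsub>D\<^esub> h y \<in> h ` G" if "x \<in> G" "y \<in> G" for x y
  proof -
    have "h x \<sqinter>\<^bsub>D\<^esub> h y = h (x \<sqinter>\<^bsub>M\<^esub> y)"
      using that G(2) h(1) by (auto simp: dba_hom_def subset_iff)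
    then show ?thesis
      using that G(4) by simp
  qed
  moreover have "w \<in> h ` G" if xw: "x \<in> G" "w \<in> carrier D" "h x \<sqsubseteq>\<^bsub>D\<^esub> w" for x w
  proof -
    obtain z where z: "z \<in> carrier M" "w = h z"
      using xw(2) h(2) by blast
    then have "x \<sqsubseteq>\<^bsub>M\<^esub> z"
      using xw(1,3) G(2) h(3)[of x z] by blast
    then show ?thesis
      using xw(1) z G(5) by blast
  qed
  ultimately have "dba_filter D (h ` G)"
    using G(2) h(2) unfolding dba_filter_def by blast
  \<comment> \<open>A surjection may send a proper subset onto everything; here \<open>G\<close> is
    the full preimage of its image, so that would force \<open>G = carrier M\<close>.\<close>
  moreover have "h ` G \<noteq> carrier D"
  proof
    assume "h ` G = carrier D"
    then have "alpha_map M h (h ` G) = carrier M"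
      unfolding alpha_map_def h(2)[symmetric] by blast
    then show False
      using alpha_map_image_filter[OF assms(1) G(1)] G(3) by simp
  qed
  moreover have "w \<in> h ` G \<or> \<^bold>\<not>\<^bsub>D\<^esub> w \<in> h ` G" if w: "w \<in> carrier D" for w
  proof -
    obtain x where x: "x \<in> carrier M" "w = h x"
      using w h(2) by blast
    then have "\<^bold>\<not>\<^bsub>D\<^esub> w = h (\<^bold>\<not>\<^bsub>M\<^esub> x)"
      using h(1) by (simp add: dba_hom_def)
    then show ?thesis
      using x G(6)[of x] by auto
  qed
  ultimately show ?thesis
    by (auto simp: primary_filters_def)
qed

text \<open>Preimage followed by image is the identity by surjectivity, image followed by preimage
  by saturation. Surjectivity also indexes the subbase of \<open>D\<close> by elements of
  \<open>M\<close>, so both maps match \<open>filters_at D (h x)\<close> with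
  \<open>filters_at M x\<close>.\<close>

lemma homeomorphic_map_alpha_map:
  assumes "double_boolean_algebra M" "dba_quasi_iso M D h"
  shows "homeomorphic_map (filter_topology D) (filter_topology M) (alpha_map M h)"
proof -
  have surj: "h ` carrier M = carrier D"
    using assms(2) by (simp add: dba_quasi_iso_def)
  note alpha = alpha_map_primary_filter[OF assms]
  note image = image_primary_filter[OF assms(2)]
  have image_alpha: "h ` alpha_map M h F = F" if "F \<in> primary_filters D" for F
  proof -
    have "F \<subseteq> h ` carrier M"
      using that surj by (simp add: primary_filters_def dba_filter_def)
    then show ?thesis
      unfolding alpha_map_def by blast
  qed
  have alpha_image: "alpha_map M h (h ` G) = G" if "G \<in> primary_filters M" for G
    using alpha_map_image_filter[OF assms(2)] that by (simp add: primary_filters_def)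
  have "continuous_map (filter_topology D) (filter_topology M) (alpha_map M h)"
    unfolding filter_topology_def
  proof (rule continuous_map_closed_subbase_topology)
    fix C assume "C \<in> filters_at M ` carrier M"
    then obtain x where x: "x \<in> carrier M" "C = filters_at M x" by blast
    have "{F \<in> primary_filters D. alpha_map M h F \<in> C} = primary_filters D \<inter> filters_at D (h x)"
      using x alpha by (auto simp: filters_at_def alpha_map_def)
    then show "\<exists>B\<in>filters_at D ` carrier D.
        {F \<in> primary_filters D. alpha_map M h F \<in> C} = primary_filters D \<inter> B"
      using x(1) surj by blast
  qed (simp add: alpha)
  moreover have "continuous_map (filter_topology M) (filter_topology D) ((`) h)"
    unfolding filter_topology_def
  proof (rule continuous_map_closed_subbase_topology)
    fix C assume "C \<in> filters_at D ` carrier D"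
    then obtain x where x: "x \<in> carrier M" "C = filters_at D (h x)"
      unfolding surj[symmetric] by blast
    \<comment> \<open>The direction from left to right needs saturation, since \<open>h x\<close>
      may come from an element of \<open>G\<close> other than \<open>x\<close>.\<close>
    have "h x \<in> h ` G \<longleftrightarrow> x \<in> G" if "G \<in> primary_filters M" for G
    proof -
      have "h x \<in> h ` G \<longleftrightarrow> x \<in> alpha_map M h (h ` G)"
        using x(1) by (simp add: alpha_map_def)
      then show ?thesis
        using alpha_image[OF that] by simp
    qed
    then have "{G \<in> primary_filters M. h ` G \<in> C} = primary_filters M \<inter> filters_at M x"
      unfolding x(2) filters_at_def using image by blast
    then show "\<exists>B\<in>filters_at M ` carrier M.
        {G \<in> primary_filters M. h ` G \<in> C} = primary_filters M \<inter> B"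
      using x(1) by blast
  qed (simp add: image)
  ultimately have "homeomorphic_maps (filter_topology D) (filter_topology M)
      (alpha_map M h) ((`) h)"
    using image_alpha alpha_image by (simp add: homeomorphic_maps_def filter_topology_def)
  then show ?thesis
    by (rule homeomorphic_maps_imp_map)
qed

text \<open>Exchanging the two negations along with meet and join turns the primary condition for
  filters into that for ideals. Extra record fields are dropped.\<close>

definition dual_dba :: "('a, 'b) dba_scheme \<Rightarrow> 'a dba"
  where "dual_dba D = \<lparr>carrier = carrier D, djoin = dmeet D, dmeet = djoin D,
    dneg = dopp D, dopp = dneg D, dtop = dbot D, dbot = dtop D\<rparr>"

lemma dual_dba_simps [simp]:
  "carrier (dual_dba D) = carrier D"
  "djoin (dual_dba D) = dmeet D" "dmeet (dual_dba D) = djoin D"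
  "dneg (dual_dba D) = dopp D" "dopp (dual_dba D) = dneg D"
  "dtop (dual_dba D) = dbot D" "dbot (dual_dba D) = dtop D"
  by (simp_all add: dual_dba_def)

lemma dvee_dual_dba [simp]: "dvee (dual_dba D) = dwedge D"
  by (intro ext) (simp add: dvee_def dwedge_def)

lemma dwedge_dual_dba [simp]: "dwedge (dual_dba D) = dvee D"
  by (intro ext) (simp add: dvee_def dwedge_def)

context double_boolean_algebra
begin

text \<open>The axioms come in dual pairs, so each obligation is an axiom of \<open>D\<close>. Only
  \<open>meet_join_idem\<close> is its own dual, with sides reversed, hence
  \<open>[symmetric]\<close>.\<close>

lemma double_boolean_algebra_dual: "double_boolean_algebra (dual_dba D)"
  by (rule double_boolean_algebra.intro; unfold dual_dba_simps dvee_dual_dba dwedge_dual_dba;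
      (rule join_closed meet_closed neg_closed opp_closed top_closed bot_closed
        meet_idem_left meet_comm meet_assoc neg_meet_idem meet_join_absorb meet_vee_distrib
        meet_vee_absorb neg_neg_meet meet_neg neg_bot neg_top join_idem_left join_comm join_assoc
        opp_join_idem join_meet_absorb join_wedge_distrib join_wedge_absorb opp_opp_join join_opp
        opp_top opp_bot meet_join_idem[symmetric]; assumption))

text \<open>Dualising swaps the two defining equations up to commutativity, which holds only on the
  carrier.\<close>

lemma dba_le_dual:
  assumes "x \<in> carrier D" "y \<in> carrier D"
  shows "x \<sqsubseteq>\<^bsub>dual_dba D\<^esub> y \<longleftrightarrow> y \<sqsubseteq> x"
  unfolding dba_le_def dual_dba_simps meet_comm[OF assms] join_comm[OF assms] by (rule conj_commute)

lemma dba_filter_dual: "dba_filter (dual_dba D) I \<longleftrightarrow> dba_ideal D I"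
  unfolding dba_filter_def dba_ideal_def dual_dba_simps
  \<comment> \<open>\<open>conj_cong\<close> makes \<open>I \<subseteq> carrier D\<close> available
    for the order clause, as \<open>dba_le_dual\<close> requires.\<close>
  by (intro conj_cong ball_cong refl) (simp add: dba_le_dual subset_iff)

lemma primary_filters_dual: "primary_filters (dual_dba D) = primary_ideals D"
  by (simp add: primary_filters_def primary_ideals_def dba_filter_dual)

lemma filter_topology_dual: "filter_topology (dual_dba D) = ideal_topology D"
proof -
  have "filters_at (dual_dba D) = ideals_at D"
    by (intro ext) (simp add: filters_at_def ideals_at_def primary_filters_dual)
  then show ?thesis
    by (simp add: filter_topology_def ideal_topology_def primary_filters_dual)
qed

end

text \<open>The preservation clauses are permuted in pairs, and the order is reversed on both sides
  of the equivalence.\<close>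

lemma dba_quasi_iso_dual:
  assumes "double_boolean_algebra M" "double_boolean_algebra D" "dba_quasi_iso M D h"
  shows "dba_quasi_iso (dual_dba M) (dual_dba D) h"
  using assms
  by (auto simp: dba_quasi_iso_def dba_hom_def double_boolean_algebra.dba_le_dual Pi_iff)

theorem mainTheorem18:
  fixes M :: "('a, 'c) dba_scheme" and D :: "('b, 'd) dba_scheme" and h :: "'a \<Rightarrow> 'b"
  assumes "double_boolean_algebra M"
    and "double_boolean_algebra D"
    and "dba_quasi_iso M D h"
  shows "CTSCR_homeomorphism (primary_top_context D) (primary_top_context M)
           (alpha_map M h) (beta_map M h)"
proof -
  have "homeomorphic_map (filter_topology (dual_dba D)) (filter_topology (dual_dba M))
      (alpha_map (dual_dba M) h)"
    using assms by (intro homeomorphic_map_alpha_map dba_quasi_iso_dual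
        double_boolean_algebra.double_boolean_algebra_dual)
  \<comment> \<open>Dualising keeps the carrier, and the preimage depends on nothing else in the
    algebra.\<close>
  moreover have "alpha_map (dual_dba M) h = beta_map M h"
    by (intro ext) (simp add: alpha_map_def beta_map_def)
  ultimately have beta: "homeomorphic_map (ideal_topology D) (ideal_topology M) (beta_map M h)"
    using assms by (simp add: double_boolean_algebra.filter_topology_dual)
  \<comment> \<open>A common element of \<open>F\<close> and \<open>I\<close> lies in the image of
    \<open>h\<close>, and any preimage of it is common to both preimages; conversely, apply
    \<open>h\<close>.\<close>
  have "F \<inter> I = {} \<longleftrightarrow> alpha_map M h F \<inter> beta_map M h I = {}"
    if "F \<in> primary_filters D" for F I
  proof -
    have "F \<subseteq> h ` carrier M"
      using that assms(3) by (simp add: primary_filters_def dba_filter_def dba_quasi_iso_def)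
    then show ?thesis
      unfolding alpha_map_def beta_map_def by blast
  qed
  then show ?thesis
    using homeomorphic_map_alpha_map[OF assms(1,3)] beta
    by (simp add: CTSCR_homeomorphism_def primary_top_context_def filter_topology_def)
qed

end
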